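(* Let $A \in \mathbb{R}^{m\times n}$, $B\in \mathbb{R}^{l\times n}$, and assume $B$ is injective. Then, for any $p\in[1,2)$, $$\|A\|_{p\mapsto1;B} \leq \frac{1}{2}\min_{(v,w)\in K} \left(\|v\|_{1}+\|w\|_{\infty}\right) \leq \sqrt{\pi/2}\cdot l^{1/p-1/2}\,\|A\|_{p\mapsto1;B},$$ where $$K := \left\{(v,w) \in \mathbb{R}^{m}\times \mathbb{R}^{l} \;\middle|\; \begin{bmatrix}\operatorname{Diag}(v) & -A\\-A^\top & B^\top\operatorname{Diag}(w)B\end{bmatrix} \succeq 0\right\}.$$
   Context: $\|A\|_{p\mapsto 1;B} := \max_{x\in\mathbb{R}^n,\ \|Bx\|_p\leq 1} \|Ax\|_1$, where $\|\cdot\|_p$ is the vector $p$-norm. A matrix is injective if the linear map it represents is injective. $\operatorname{Diag}(v)$ is the diagonal matrix with the entries of $v$ on its diagonal, and $\succeq 0$ means positive semidefinite. *)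

theory Defs
  imports "HOL-Analysis.Analysis"
begin

definition lp_norm :: "real \<Rightarrow> real ^ 'n \<Rightarrow> real"
  where "lp_norm p x = (\<Sum>i\<in>UNIV. \<bar>x $ i\<bar> powr p) powr (1 / p)"

text \<open>The maximum exists whenever \<open>B\<close> is injective and \<open>p \<ge> 1\<close>; otherwise the value is
  unspecified.\<close>

definition norm_p_to_1 :: "real \<Rightarrow> real ^ 'n ^ 'm \<Rightarrow> real ^ 'n ^ 'l \<Rightarrow> real"
  where "norm_p_to_1 p A B =
    (GREATEST r. r \<in> (\<lambda>x. lp_norm 1 (A *v x)) ` {x. lp_norm p (B *v x) \<le> 1})"

definition Diag :: "real ^ 'n \<Rightarrow> real ^ 'n ^ 'n"
  where "Diag v = (\<chi> i j. if i = j then v $ i else 0)"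

definition psd :: "real ^ 'n ^ 'n \<Rightarrow> bool"
  where "psd M \<longleftrightarrow> transpose M = M \<and> (\<forall>x. 0 \<le> x \<bullet> (M *v x))"

text \<open>\<open>block_mat P Q R S\<close> is the matrix with block rows \<open>[P Q]\<close> and \<open>[R S]\<close>; its rows and
  columns are indexed by sum types.\<close>

definition block_mat ::
  "real ^ 'a ^ 'c \<Rightarrow> real ^ 'b ^ 'c \<Rightarrow> real ^ 'a ^ 'd \<Rightarrow> real ^ 'b ^ 'd \<Rightarrow> real ^ ('a + 'b) ^ ('c + 'd)"
  where "block_mat P Q R S = (\<chi> i j.
    case i of
      Inl c \<Rightarrow> (case j of Inl a \<Rightarrow> P $ c $ a | Inr b \<Rightarrow> Q $ c $ b)
    | Inr d \<Rightarrow> (case j of Inl a \<Rightarrow> R $ d $ a | Inr b \<Rightarrow> S $ d $ b))"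

definition K_set :: "real ^ 'n ^ 'm \<Rightarrow> real ^ 'n ^ 'l \<Rightarrow> ((real ^ 'm) \<times> (real ^ 'l)) set"
  where "K_set A B = {(v, w).
    psd (block_mat (Diag v) (- A) (- transpose A) (transpose B ** Diag w ** B))}"

text \<open>The minimum of \<open>\<parallel>v\<parallel>\<^sub>1 + \<parallel>w\<parallel>\<^sub>\<infinity>\<close> over \<open>K_set A B\<close>, without the factor 1/2. It is attained
  whenever \<open>B\<close> is injective. \<^const>\<open>infnorm\<close> is the maximum norm on \<^typ>\<open>real ^ 'l\<close>.\<close>

definition sdp_min :: "real ^ 'n ^ 'm \<Rightarrow> real ^ 'n ^ 'l \<Rightarrow> real"
  where "sdp_min A B = (LEAST r. r \<in> (\<lambda>(v, w). lp_norm 1 v + infnorm w) ` K_set A B)"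

end

theory Submission
  imports Defs "HOL-Probability.Probability"
begin

text \<open>For \<open>p \<le> 2\<close> the constraint \<open>\<parallel>B x\<parallel>\<^sub>p \<le> 1\<close> implies \<open>\<parallel>B x\<parallel>\<^sub>2 \<le> 1\<close>, while
  \<open>\<parallel>B x\<parallel>\<^sub>2 \<le> 1\<close> implies \<open>\<parallel>B x\<parallel>\<^sub>p \<le> l\<^bsup>1/p - 1/2\<^esup>\<close>. Replacing the \<open>p\<close>-norm by the Euclidean norm
  thus costs exactly the factor in \<open>l\<close>, and the factor \<open>\<surd>(\<pi>/2)\<close> has to be the price of the
  semidefinite relaxation of \<open>max {\<parallel>A x\<parallel>\<^sub>1 | \<parallel>B x\<parallel>\<^sub>2 \<le> 1}\<close>.

  The relaxation becomes transparent after squaring: \<open>\<parallel>A x\<parallel>\<^sub>1\<close> is \<open>\<Sum>\<^sub>i \<surd>s\<^sub>i\<close> with \<open>s\<^sub>i = ((A x)\<^sub>i)\<^sup>2\<close>, and the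
  concave function \<open>\<Sum>\<^sub>i \<surd>s\<^sub>i\<close> can be maximised over the convex hull of the attainable vectors \<open>s\<close>
  (\<open>relaxed_set\<close>). Its maximum \<open>\<sigma>\<close> is attained because injectivity of \<open>B\<close> makes the hull compact.
  The semidefinite minimum is the dual of this problem, and it equals \<open>2\<sigma>\<close>. Weak duality
  (\<open>weak_duality\<close>) tests the semidefinite constraint against the vectors \<open>y\<^sub>i = (A x)\<^sub>i / \<surd>s\<^sub>i\<close>; the
  resulting inequality is affine in the squares \<open>((A x)\<^sub>i)\<^sup>2\<close>, so it passes to the convex hull.
  Equality (\<open>relaxed_optimum_gives_feasible_point\<close>) is the first-order optimality condition at a
  maximiser \<open>s\<close>, which says that \<open>v\<^sub>i = \<surd>s\<^sub>i\<close> and \<open>w = (\<sigma>, \<dots>, \<sigma>)\<close> are feasible.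

  The lower bound is then immediate, since the vectors of squares lie in the hull. For the upper
  bound, write the maximiser as a convex combination \<open>\<Sum>\<^sub>k u\<^sub>k ((A x\<^sub>k)\<^sub>i)\<^sup>2\<close> and take the random vector
  \<open>z = \<Sum>\<^sub>k \<surd>u\<^sub>k g\<^sub>k x\<^sub>k\<close> with independent standard Gaussians \<open>g\<^sub>k\<close>. Then \<open>(A z)\<^sub>i\<close> is a centred Gaussian
  of variance \<open>s\<^sub>i\<close>, so the expectation of \<open>\<parallel>A z\<parallel>\<^sub>1\<close> is \<open>\<surd>(2/\<pi>) \<sigma>\<close>, whereas \<open>\<parallel>B z\<parallel>\<^sub>2\<^sup>2\<close> has expectation at
  most \<open>1\<close> (\<open>root_sum_le_norm_bound\<close>).\<close>

section \<open>The vector p-norm against the Euclidean norm\<close>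

lemma lp_norm_1: "lp_norm 1 x = (\<Sum>i\<in>UNIV. \<bar>x $ i\<bar>)"
  by (simp add: lp_norm_def sum_nonneg)

lemma lp_norm_scaleR:
  assumes "0 < p"
  shows "lp_norm p (c *\<^sub>R x) = \<bar>c\<bar> * lp_norm p x"
  using assms
  by (simp add: lp_norm_def abs_mult powr_mult sum_nonneg powr_powr flip: sum_distrib_left)

lemma continuous_lp_norm:
  assumes "0 < p"
  shows "continuous_on UNIV (lp_norm p)"
  unfolding lp_norm_def using assms
  by (intro continuous_on_powr' continuous_intros) (auto simp: sum_nonneg)

lemma norm_vec_sq: "(norm (x :: real ^ 'n))\<^sup>2 = (\<Sum>i\<in>UNIV. (x $ i)\<^sup>2)"
  by (simp add: norm_vec_def L2_set_def sum_nonneg)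

text \<open>In the unit ball of the \<open>p\<close>-norm all coordinates are at most \<open>1\<close> in absolute value, and there
  \<open>a\<^sup>2 \<le> a\<^bsup>p\<^esup>\<close>.\<close>

lemma norm_le_1_if_lp_norm_le_1:
  fixes x :: "real ^ 'n"
  assumes "0 < p" "p \<le> 2" "lp_norm p x \<le> 1"
  shows "norm x \<le> 1"
proof -
  let ?S = "\<Sum>i\<in>UNIV. \<bar>x $ i\<bar> powr p"
  have S: "?S \<le> 1"
  proof (rule ccontr)
    assume "\<not> ?S \<le> 1"
    then have "1 < ?S powr (1 / p)"
      using assms(1) by (intro gr_one_powr) auto
    then show False
      using assms(3) by (simp add: lp_norm_def)
  qed
  have "(x $ i)\<^sup>2 \<le> \<bar>x $ i\<bar> powr p" for i
  proof (cases "x $ i = 0")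
    case False
    have "\<bar>x $ i\<bar> powr p \<le> ?S"
      by (rule member_le_sum) auto
    then have "\<bar>x $ i\<bar> powr p \<le> 1"
      using S by linarith
    then have "\<bar>x $ i\<bar> \<le> 1"
      using gr_one_powr[of "\<bar>x $ i\<bar>" p] assms(1) by linarith
    then have "\<bar>x $ i\<bar> powr 2 \<le> \<bar>x $ i\<bar> powr p"
      using assms(2) by (intro powr_mono') auto
    then show ?thesis
      using False by simp
  qed simp
  then have "(norm x)\<^sup>2 \<le> ?S"
    unfolding norm_vec_sq by (intro sum_mono)
  then have "(norm x)\<^sup>2 \<le> 1"
    using S by linarith
  then show ?thesis
    by (simp add: power2_le_iff_abs_le abs_square_le_1)
qed

text \<open>The sharp comparison constant is attained at the vector with all \<open>x\<^sub>i\<^sup>2 = 1/n\<close>. Hence it suffices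
  to bound the concave function \<open>a \<mapsto> a\<^bsup>p/2\<^esup>\<close> by its tangent at that point and to sum up.\<close>

lemma lp_norm_le_if_norm_le_1:
  fixes x :: "real ^ 'n"
  assumes "0 < p" "p \<le> 2" "norm x \<le> 1"
  shows "lp_norm p x \<le> real CARD('n) powr (1 / p - 1 / 2)"
proof -
  let ?d = "real CARD('n)"
  have d: "0 < ?d" by simp
  have tangent: "\<bar>x $ i\<bar> powr p \<le> ?d powr (- p / 2) * (p / 2 * (?d * (x $ i)\<^sup>2) + (1 - p / 2))" for i
  proof (cases "x $ i = 0")
    case True
    then show ?thesis using assms by simp
  next
    case False
    have "(?d * (x $ i)\<^sup>2) powr (p / 2) * 1 powr (1 - p / 2) \<le> p / 2 * (?d * (x $ i)\<^sup>2) + (1 - p / 2) * 1"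
      using assms False by (intro Youngs_inequality_0) auto
    moreover have "((x $ i)\<^sup>2) powr (p / 2) = \<bar>x $ i\<bar> powr p"
      using False powr_powr[of "\<bar>x $ i\<bar>" 2 "p / 2"] by simp
    ultimately have "?d powr (p / 2) * \<bar>x $ i\<bar> powr p \<le> p / 2 * (?d * (x $ i)\<^sup>2) + (1 - p / 2)"
      by (simp add: powr_mult)
    then have "?d powr (- p / 2) * (?d powr (p / 2) * \<bar>x $ i\<bar> powr p)
        \<le> ?d powr (- p / 2) * (p / 2 * (?d * (x $ i)\<^sup>2) + (1 - p / 2))"
      by (intro mult_left_mono) auto
    moreover have "?d powr (- p / 2) * (?d powr (p / 2) * \<bar>x $ i\<bar> powr p) = \<bar>x $ i\<bar> powr p"
      using d by (simp flip: powr_add mult.assoc)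
    ultimately show ?thesis by (simp only:)
  qed
  have "(norm x)\<^sup>2 \<le> 1"
    using assms(3) by (simp add: abs_square_le_1)
  then have sum_le: "p / 2 * ?d * (norm x)\<^sup>2 \<le> p / 2 * ?d * 1"
    using assms(1) by (intro mult_left_mono) auto
  have "(\<Sum>i\<in>UNIV. \<bar>x $ i\<bar> powr p)
      \<le> (\<Sum>i\<in>UNIV. ?d powr (- p / 2) * (p / 2 * (?d * (x $ i)\<^sup>2) + (1 - p / 2)))"
    by (intro sum_mono tangent)
  also have "\<dots> = ?d powr (- p / 2) * (\<Sum>i\<in>UNIV. p / 2 * (?d * (x $ i)\<^sup>2) + (1 - p / 2))"
    by (simp only: sum_distrib_left)
  also have "(\<Sum>i\<in>UNIV. p / 2 * (?d * (x $ i)\<^sup>2) + (1 - p / 2))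
      = p / 2 * ?d * (norm x)\<^sup>2 + ?d * (1 - p / 2)"
    by (simp add: norm_vec_sq sum.distrib sum_distrib_left sum_divide_distrib mult.assoc)
  also have "?d powr (- p / 2) * (p / 2 * ?d * (norm x)\<^sup>2 + ?d * (1 - p / 2))
      \<le> ?d powr (- p / 2) * (p / 2 * ?d * 1 + ?d * (1 - p / 2))"
    by (rule mult_left_mono[OF add_right_mono[OF sum_le]]) simp
  also have "\<dots> = ?d powr (- p / 2) * ?d powr 1"
    by (simp add: algebra_simps)
  also have "\<dots> = ?d powr (1 - p / 2)"
    by (subst powr_add[symmetric]) simp
  finally have "lp_norm p x \<le> (?d powr (1 - p / 2)) powr (1 / p)"
    unfolding lp_norm_def using assms(1) by (intro powr_mono2) (auto simp: sum_nonneg)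
  also have "\<dots> = ?d powr (1 / p - 1 / 2)"
    using assms(1) by (simp add: powr_powr field_simps)
  finally show ?thesis .
qed

section \<open>The operator norm\<close>

text \<open>Injectivity of \<open>B\<close> enters here: without it the ball would contain a line.\<close>

lemma compact_norm_ball_preimage:
  fixes B :: "real ^ 'n ^ 'l"
  assumes "inj ((*v) B)"
  shows "compact {x. norm (B *v x) \<le> 1}"
proof -
  obtain c where c: "0 < c" "\<And>x. c * norm x \<le> norm (B *v x)"
    using linear_inj_bounded_below_pos[OF matrix_vector_mul_linear assms] by blast
  have "norm x \<le> 1 / c" if "norm (B *v x) \<le> 1" for x
    using c(1) c(2)[of x] that by (simp add: field_simps)
  then have "bounded {x. norm (B *v x) \<le> 1}"
    unfolding bounded_iff by blast
  moreover have "closed {x. norm (B *v x) \<le> 1}"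
    by (intro closed_Collect_le continuous_intros linear_continuous_on matrix_vector_mul_bounded_linear)
  ultimately show ?thesis
    by (simp add: compact_eq_bounded_closed)
qed

lemma norm_p_to_1_attained:
  fixes A :: "real ^ 'n ^ 'm" and B :: "real ^ 'n ^ 'l"
  assumes "inj ((*v) B)" "0 < p" "p \<le> 2"
  obtains x where "lp_norm p (B *v x) \<le> 1" "norm_p_to_1 p A B = lp_norm 1 (A *v x)"
    and "\<And>y. lp_norm p (B *v y) \<le> 1 \<Longrightarrow> lp_norm 1 (A *v y) \<le> norm_p_to_1 p A B"
proof -
  let ?C = "{x. lp_norm p (B *v x) \<le> 1}"
  have cont: "continuous_on UNIV (\<lambda>x. lp_norm q (M *v x))" if "0 < q" for q and M :: "real ^ 'n ^ 'r"
    using continuous_on_compose2[OF continuous_lp_norm[OF that], of UNIV "(*v) M"]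
    by (simp add: linear_continuous_on matrix_vector_mul_bounded_linear)
  have "?C \<subseteq> {x. norm (B *v x) \<le> 1}"
    using norm_le_1_if_lp_norm_le_1[OF assms(2,3)] by blast
  moreover have "closed ?C"
    by (intro closed_Collect_le cont assms continuous_intros)
  ultimately have "compact ?C"
    using compact_norm_ball_preimage[OF assms(1)] compact_Int_closed
    by (metis inf.absorb_iff2)
  moreover have "0 \<in> ?C"
    by (simp add: lp_norm_def)
  ultimately obtain x where x: "x \<in> ?C" "\<forall>y\<in>?C. lp_norm 1 (A *v y) \<le> lp_norm 1 (A *v x)"
    using continuous_attains_sup[of ?C "\<lambda>x. lp_norm 1 (A *v x)"] continuous_on_subset[OF cont[of 1 A]]
    by (metis (no_types, lifting) empty_iff subset_UNIV zero_less_one)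
  have "norm_p_to_1 p A B = lp_norm 1 (A *v x)"
    unfolding norm_p_to_1_def using x by (intro Greatest_equality) auto
  then show ?thesis
    using x that by auto
qed

text \<open>The operator norm was defined through the \<open>p\<close>-norm of \<open>B x\<close>; the homogeneous form of the bound
  in terms of the Euclidean norm is the one to which Gaussian averaging applies.\<close>

lemma norm_p_to_1_bound:
  fixes A :: "real ^ 'n ^ 'm" and B :: "real ^ 'n ^ 'l"
  assumes "inj ((*v) B)" "0 < p" "p \<le> 2"
  shows "lp_norm 1 (A *v x) \<le> real CARD('l) powr (1 / p - 1 / 2) * norm_p_to_1 p A B * norm (B *v x)"
proof (cases "x = 0")
  case True
  then show ?thesis by (simp add: lp_norm_1)
next
  case False
  let ?c = "real CARD('l) powr (1 / p - 1 / 2)"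
  define r where "r = norm (B *v x)"
  have r: "0 < r"
    using False injD[OF assms(1), of x 0] by (auto simp: r_def)
  have c: "0 < ?c" by simp
  have "norm ((1 / r) *\<^sub>R (B *v x)) \<le> 1"
    using r by (simp add: r_def)
  from lp_norm_le_if_norm_le_1[OF assms(2,3) this]
  have "lp_norm p (B *v ((1 / (?c * r)) *\<^sub>R x)) \<le> 1"
    using r c assms(2) by (simp add: matrix_vector_mult_scaleR lp_norm_scaleR field_simps)
  then have "lp_norm 1 (A *v ((1 / (?c * r)) *\<^sub>R x)) \<le> norm_p_to_1 p A B"
    using norm_p_to_1_attained[OF assms, of A] by metis
  then show ?thesis
    using r c by (simp add: matrix_vector_mult_scaleR lp_norm_scaleR field_simps flip: r_def)
qed

section \<open>The semidefinite constraint as a family of quadratic inequalities\<close>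

definition join :: "real ^ 'm \<Rightarrow> real ^ 'n \<Rightarrow> real ^ ('m + 'n)"
  where "join y x = (\<chi> k. case k of Inl i \<Rightarrow> y $ i | Inr j \<Rightarrow> x $ j)"

lemma sum_UNIV_Plus:
  "(\<Sum>k\<in>UNIV. f k) = (\<Sum>i\<in>UNIV. f (Inl i)) + (\<Sum>j\<in>UNIV. f (Inr j))"
  for f :: "'m::finite + 'n::finite \<Rightarrow> real"
  by (simp add: sum.Plus flip: UNIV_Plus_UNIV)

lemma join_inner: "join a b \<bullet> join c d = a \<bullet> c + b \<bullet> d"
  by (simp add: inner_vec_def join_def sum_UNIV_Plus)

lemma block_mat_mult_join:
  "block_mat P Q R S *v join y x = join (P *v y + Q *v x) (R *v y + S *v x)"
  by (simp add: vec_eq_iff matrix_vector_mult_def block_mat_def join_def sum_UNIV_Plus split: sum.split)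

lemma join_surj: "\<exists>y x. z = join y x"
  by (intro exI[of _ "\<chi> i. z $ Inl i"] exI[of _ "\<chi> j. z $ Inr j"])
     (simp add: vec_eq_iff join_def split: sum.split)

lemma Diag_mult: "Diag v *v y = (\<chi> i. v $ i * y $ i)"
  by (simp add: vec_eq_iff Diag_def matrix_vector_mult_def if_distrib[of "\<lambda>a. a * _"] cong: if_cong)

lemma transpose_block_mat:
  "transpose (block_mat P Q R S) = block_mat (transpose P) (transpose R) (transpose Q) (transpose S)"
  by (simp add: vec_eq_iff transpose_def block_mat_def split: sum.split)

lemma transpose_Diag: "transpose (Diag v) = Diag v"
  by (simp add: vec_eq_iff transpose_def Diag_def)

lemma transpose_uminus: "transpose (- A) = - transpose (A :: real ^ 'n ^ 'm)"
  by (simp add: vec_eq_iff transpose_def)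

lemma uminus_matrix_vector_mult: "(- A) *v x = - (A *v x)" for A :: "real ^ 'n ^ 'm"
  by (simp add: vec_eq_iff matrix_vector_mult_def sum_negf)

text \<open>The quadratic form of the block matrix at the vector with parts \<open>y\<close> and \<open>x\<close> is the
  difference of the two sides.\<close>

lemma K_set_iff:
  fixes A :: "real ^ 'n ^ 'm" and B :: "real ^ 'n ^ 'l"
  shows "(v, w) \<in> K_set A B \<longleftrightarrow>
    (\<forall>y x. 2 * (\<Sum>i\<in>UNIV. y $ i * (A *v x) $ i)
      \<le> (\<Sum>i\<in>UNIV. v $ i * (y $ i)\<^sup>2) + (\<Sum>j\<in>UNIV. w $ j * ((B *v x) $ j)\<^sup>2))"
proof -
  let ?M = "block_mat (Diag v) (- A) (- transpose A) (transpose B ** Diag w ** B)"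
  have adj: "x \<bullet> (transpose M *v y) = y \<bullet> (M *v x)" for M :: "real ^ 'n ^ 'r" and x y
    by (simp add: transpose_matrix_vector inner_commute flip: dot_lmul_matrix)
  have quad: "join y x \<bullet> (?M *v join y x) = (\<Sum>i\<in>UNIV. v $ i * (y $ i)\<^sup>2)
      + (\<Sum>j\<in>UNIV. w $ j * ((B *v x) $ j)\<^sup>2) - 2 * (\<Sum>i\<in>UNIV. y $ i * (A *v x) $ i)" for y x
  proof -
    have "join y x \<bullet> (?M *v join y x) = y \<bullet> (Diag v *v y) - 2 * (y \<bullet> (A *v x))
        + (Diag w *v (B *v x)) \<bullet> (B *v x)"
      by (simp add: block_mat_mult_join join_inner uminus_matrix_vector_mult inner_add_right
          inner_diff_right adj del: transpose_matrix_vector flip: matrix_vector_mul_assoc)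
    then show ?thesis
      by (simp add: Diag_mult inner_vec_def power2_eq_square mult_ac)
  qed
  have "transpose ?M = ?M"
    by (simp add: transpose_block_mat transpose_Diag transpose_uminus matrix_transpose_mul matrix_mul_assoc)
  moreover have "(\<forall>z. 0 \<le> z \<bullet> (?M *v z)) \<longleftrightarrow> (\<forall>y x. 0 \<le> join y x \<bullet> (?M *v join y x))"
    by (metis join_surj)
  ultimately show ?thesis
    by (simp add: K_set_def psd_def quad)
qed


section \<open>The relaxed problem and its optimality conditions\<close>

definition square_image :: "real ^ 'n ^ 'm \<Rightarrow> real ^ 'n \<Rightarrow> real ^ 'm"
  where "square_image A x = (\<chi> i. ((A *v x) $ i)\<^sup>2)"

text \<open>For injective \<open>B\<close> these are the vectors \<open>(a\<^sub>i \<bullet> Z a\<^sub>i)\<^sub>i\<close> for the rows \<open>a\<^sub>i\<close> of \<open>A\<close> and the positive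
  semidefinite \<open>Z\<close> for which \<open>B Z B\<^sup>T\<close> has trace at most \<open>1\<close>. The convex hull comes with its compactness
  and with explicit convex combinations, so that no matrix has to be factorised.\<close>

definition relaxed_set :: "real ^ 'n ^ 'm \<Rightarrow> real ^ 'n ^ 'l \<Rightarrow> (real ^ 'm) set"
  where "relaxed_set A B = convex hull (square_image A ` {x. norm (B *v x) \<le> 1})"

definition root_sum :: "real ^ 'm \<Rightarrow> real"
  where "root_sum s = (\<Sum>i\<in>UNIV. sqrt (s $ i))"

lemma root_sum_square_image: "root_sum (square_image A x) = lp_norm 1 (A *v x)"
  by (simp add: root_sum_def square_image_def lp_norm_1)

lemma relaxed_set_generator:
  "norm (B *v x) \<le> 1 \<Longrightarrow> square_image A x \<in> relaxed_set A B"
  unfolding relaxed_set_def by (intro hull_inc) auto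

lemma convex_relaxed_set: "convex (relaxed_set A B)"
  unfolding relaxed_set_def by (rule convex_convex_hull)

lemma relaxed_set_nonneg:
  assumes "t \<in> relaxed_set A B"
  shows "0 \<le> t $ i"
proof -
  have "relaxed_set A B \<subseteq> {t. 0 \<le> t $ i}"
    unfolding relaxed_set_def
    by (intro hull_minimal) (auto simp: square_image_def convex_def)
  then show ?thesis using assms by blast
qed

lemma relaxed_optimum_exists:
  fixes A :: "real ^ 'n ^ 'm" and B :: "real ^ 'n ^ 'l"
  assumes "inj ((*v) B)"
  obtains s where "s \<in> relaxed_set A B"
    and "\<And>t. t \<in> relaxed_set A B \<Longrightarrow> root_sum t \<le> root_sum s"
proof -
  have "continuous_on UNIV (square_image A)"
    unfolding square_image_def
    by (intro continuous_intros linear_continuous_on matrix_vector_mul_bounded_linear)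
  then have "compact (square_image A ` {x. norm (B *v x) \<le> 1})"
    by (intro compact_continuous_image compact_norm_ball_preimage assms) (auto intro: continuous_on_subset)
  then have "compact (relaxed_set A B)"
    unfolding relaxed_set_def by (rule compact_convex_hull)
  moreover have "relaxed_set A B \<noteq> {}"
    using relaxed_set_generator[of B 0 A] by auto
  moreover have "continuous_on (relaxed_set A B) root_sum"
    unfolding root_sum_def by (intro continuous_intros)
  ultimately show ?thesis
    using continuous_attains_sup that by metis
qed

text \<open>The square root has infinite slope at \<open>0\<close>: moving from \<open>s\<close> towards \<open>t\<close> by a small \<open>e\<close> would gain
  \<open>\<surd>(e t\<^sub>i)\<close> in a coordinate with \<open>s\<^sub>i = 0 < t\<^sub>i\<close> and lose at most \<open>e \<Sum>\<^sub>j \<surd>s\<^sub>j\<close> in the others.\<close>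

lemma root_sum_optimum_support:
  fixes s t :: "real ^ 'm"
  assumes "convex H" and nonneg: "\<And>t i. t \<in> H \<Longrightarrow> 0 \<le> t $ i"
    and "s \<in> H" and max: "\<And>t. t \<in> H \<Longrightarrow> root_sum t \<le> root_sum s"
    and "t \<in> H" "s $ i = 0"
  shows "t $ i = 0"
proof (rule ccontr)
  assume "t $ i \<noteq> 0"
  then have ti: "0 < t $ i"
    using nonneg[OF \<open>t \<in> H\<close>, of i] by simp
  \<comment> \<open>small enough that \<open>e (\<Sum>\<^sub>j \<surd>s\<^sub>j)\<^sup>2 < t\<^sub>i\<close>, which makes the gain exceed the loss\<close>
  define e where "e = t $ i / (t $ i + (root_sum s)\<^sup>2)"
  have e: "0 < e" "e \<le> 1"
    using ti by (auto simp: e_def divide_le_eq add_pos_nonneg)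
  define u where "u = (1 - e) *\<^sub>R s + e *\<^sub>R t"
  have "u \<in> H"
    unfolding u_def using e assms by (intro convexD) auto
  have root: "(1 - e) * sqrt (s $ j) + (if j = i then sqrt (e * t $ i) else 0) \<le> sqrt (u $ j)" for j
  proof (cases "j = i")
    case True
    then show ?thesis using \<open>s $ i = 0\<close> by (simp add: u_def)
  next
    case False
    have "(1 - e)\<^sup>2 \<le> 1 - e"
      using e by (simp add: power2_eq_square mult_le_cancel_left2)
    then have "(1 - e)\<^sup>2 * s $ j \<le> (1 - e) * s $ j"
      using nonneg[OF \<open>s \<in> H\<close>] by (intro mult_right_mono) auto
    also have "\<dots> \<le> u $ j"
      using e nonneg[OF \<open>t \<in> H\<close>] by (simp add: u_def)
    finally have "sqrt ((1 - e)\<^sup>2 * s $ j) \<le> sqrt (u $ j)"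
      by simp
    then show ?thesis
      using False e by (simp add: real_sqrt_mult)
  qed
  have "(1 - e) * root_sum s + sqrt (e * t $ i)
      = (\<Sum>j\<in>UNIV. (1 - e) * sqrt (s $ j) + (if j = i then sqrt (e * t $ i) else 0))"
    by (simp add: root_sum_def sum.distrib sum_distrib_left)
  also have "\<dots> \<le> root_sum u"
    unfolding root_sum_def by (intro sum_mono root)
  also have "\<dots> \<le> root_sum s"
    using \<open>u \<in> H\<close> by (rule max)
  finally have "sqrt (e * t $ i) \<le> e * root_sum s"
    by (simp add: algebra_simps)
  then have "e * t $ i \<le> (e * root_sum s)\<^sup>2"
    by (rule sqrt_le_D)
  then have "t $ i \<le> e * (root_sum s)\<^sup>2"
    using e by (simp add: power2_eq_square mult_ac)
  then have "t $ i * (t $ i + (root_sum s)\<^sup>2) \<le> t $ i * (root_sum s)\<^sup>2"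
    using ti by (simp add: e_def field_simps add_pos_nonneg)
  then have "t $ i * t $ i \<le> 0"
    by (simp add: algebra_simps)
  then show False
    using ti by (simp add: mult_le_0_iff)
qed

text \<open>The directional derivative at \<open>s\<close> towards \<open>t\<close> is half of
  \<open>\<Sum>\<^sub>i t\<^sub>i/\<surd>s\<^sub>i - \<Sum>\<^sub>i \<surd>s\<^sub>i\<close> and cannot be positive at a maximum. Coordinates with \<open>s\<^sub>i = 0\<close> contribute
  \<open>0\<close> to the sum on the left, by the convention for division by zero.\<close>

lemma root_sum_optimum_gradient:
  fixes s t :: "real ^ 'm"
  assumes "convex H" and nonneg: "\<And>t i. t \<in> H \<Longrightarrow> 0 \<le> t $ i"
    and "s \<in> H" and max: "\<And>t. t \<in> H \<Longrightarrow> root_sum t \<le> root_sum s"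
    and "t \<in> H"
  shows "(\<Sum>i\<in>UNIV. t $ i / sqrt (s $ i)) \<le> root_sum s"
proof (rule ccontr)
  assume gt: "\<not> ?thesis"
  let ?J = "{i. s $ i \<noteq> 0}"
  \<comment> \<open>coordinates outside \<open>?J\<close> are dropped since the root is not differentiable there\<close>
  let ?\<phi> = "\<lambda>e. \<Sum>i\<in>?J. sqrt (s $ i + e * (t $ i - s $ i))"
  let ?D = "\<Sum>i\<in>?J. (t $ i - s $ i) / (2 * sqrt (s $ i))"
  have pos: "0 < s $ i" if "i \<in> ?J" for i
    using that nonneg[OF \<open>s \<in> H\<close>, of i] by simp
  have "(?\<phi> has_real_derivative ?D) (at 0)"
  proof (rule DERIV_sum)
    fix i assume "i \<in> ?J"
    then show "((\<lambda>e. sqrt (s $ i + e * (t $ i - s $ i))) has_real_derivative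
        (t $ i - s $ i) / (2 * sqrt (s $ i))) (at 0)"
      using pos[of i] by (auto intro!: derivative_eq_intros simp: field_simps)
  qed
  moreover have "?D = ((\<Sum>i\<in>UNIV. t $ i / sqrt (s $ i)) - root_sum s) / 2"
  proof -
    have "(t $ i - s $ i) / (2 * sqrt (s $ i)) = (t $ i / sqrt (s $ i) - s $ i / sqrt (s $ i)) / 2" for i
      by (simp only: diff_divide_distrib divide_divide_eq_left mult.commute[of 2])
    then have "(t $ i - s $ i) / (2 * sqrt (s $ i)) = (t $ i / sqrt (s $ i) - sqrt (s $ i)) / 2" for i
      using nonneg[OF \<open>s \<in> H\<close>, of i] by (simp only: real_div_sqrt)
    then have "?D = (\<Sum>i\<in>?J. (t $ i / sqrt (s $ i) - sqrt (s $ i)) / 2)"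
      by (simp only:)
    also have "\<dots> = (\<Sum>i\<in>UNIV. (t $ i / sqrt (s $ i) - sqrt (s $ i)) / 2)"
      by (rule sum.mono_neutral_left) auto
    finally show ?thesis
      by (simp add: root_sum_def sum_subtractf flip: sum_divide_distrib)
  qed
  moreover have "0 < ((\<Sum>i\<in>UNIV. t $ i / sqrt (s $ i)) - root_sum s) / 2"
    using gt by simp
  ultimately have "\<exists>d>0. \<forall>h>0. h < d \<longrightarrow> ?\<phi> 0 < ?\<phi> (0 + h)"
    by (intro DERIV_pos_inc_right[of ?\<phi> ?D 0]) (simp_all only:)
  then obtain d where d: "0 < d" "\<And>h. 0 < h \<Longrightarrow> h < d \<Longrightarrow> ?\<phi> 0 < ?\<phi> h"
    by (auto simp only: add_0)
  define h where "h = min 1 (d / 2)"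
  have h: "0 < h" "h < d" "h \<le> 1"
    using d(1) by (auto simp: h_def)
  define u where "u = (1 - h) *\<^sub>R s + h *\<^sub>R t"
  have "u \<in> H"
    unfolding u_def using h assms by (intro convexD) auto
  have "root_sum s = ?\<phi> 0"
    unfolding root_sum_def by (simp, rule sum.mono_neutral_right) auto
  also have "\<dots> < ?\<phi> h"
    using d h by blast
  also have "\<dots> = (\<Sum>i\<in>?J. sqrt (u $ i))"
    by (simp add: u_def algebra_simps)
  also have "\<dots> \<le> root_sum u"
    unfolding root_sum_def using nonneg[OF \<open>u \<in> H\<close>] by (intro sum_mono2) auto
  finally show False
    using max[OF \<open>u \<in> H\<close>] by simp
qed

section \<open>Strong duality\<close>

text \<open>The test vector \<open>y\<^sub>i = (A x)\<^sub>i / \<surd>s\<^sub>i\<close> turns the constraint into \<open>g \<bullet> t \<le> \<parallel>w\<parallel>\<^sub>\<infinity>\<close> for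
  \<open>t\<^sub>i = ((A x)\<^sub>i)\<^sup>2\<close>. The half-space of all such \<open>t\<close> is convex, so it contains \<open>s\<close> itself, and there
  \<open>g \<bullet> s\<close> is at least \<open>2 \<Sum>\<^sub>i \<surd>s\<^sub>i - \<parallel>v\<parallel>\<^sub>1\<close>.\<close>

lemma weak_duality:
  fixes A :: "real ^ 'n ^ 'm" and B :: "real ^ 'n ^ 'l"
  assumes K: "(v, w) \<in> K_set A B" and s: "s \<in> relaxed_set A B"
  shows "2 * root_sum s \<le> lp_norm 1 v + infnorm w"
proof -
  define a where "a i = 1 / sqrt (s $ i)" for i
  define g :: "real ^ 'm" where "g = (\<chi> i. 2 * a i - v $ i * (a i)\<^sup>2)"
  have "g \<bullet> square_image A x \<le> infnorm w" if x: "norm (B *v x) \<le> 1" for x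
  proof -
    have "2 * (\<Sum>i\<in>UNIV. a i * (A *v x) $ i * (A *v x) $ i)
        \<le> (\<Sum>i\<in>UNIV. v $ i * (a i * (A *v x) $ i)\<^sup>2) + (\<Sum>j\<in>UNIV. w $ j * ((B *v x) $ j)\<^sup>2)"
      using K unfolding K_set_iff by (elim allE[of _ "\<chi> i. a i * (A *v x) $ i"] allE[of _ x]) simp
    moreover have "g \<bullet> square_image A x = 2 * (\<Sum>i\<in>UNIV. a i * (A *v x) $ i * (A *v x) $ i)
        - (\<Sum>i\<in>UNIV. v $ i * (a i * (A *v x) $ i)\<^sup>2)"
      by (simp add: inner_vec_def g_def square_image_def sum_distrib_left power2_eq_square
          algebra_simps flip: sum_subtractf)
    moreover have "(\<Sum>j\<in>UNIV. w $ j * ((B *v x) $ j)\<^sup>2) \<le> (\<Sum>j\<in>UNIV. infnorm w * ((B *v x) $ j)\<^sup>2)"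
      using component_le_infnorm_cart[of w] by (intro sum_mono mult_right_mono) (auto simp: abs_le_iff)
    moreover have "\<dots> = infnorm w * (norm (B *v x))\<^sup>2"
      by (simp add: norm_vec_sq sum_distrib_left)
    moreover have "\<dots> \<le> infnorm w"
      using x by (simp add: infnorm_pos_le mult_left_le abs_square_le_1)
    ultimately show ?thesis by linarith
  qed
  then have "relaxed_set A B \<subseteq> {t. g \<bullet> t \<le> infnorm w}"
    unfolding relaxed_set_def by (intro hull_minimal convex_halfspace_le) auto
  then have "g \<bullet> s \<le> infnorm w"
    using s by blast
  moreover have "2 * sqrt (s $ i) - \<bar>v $ i\<bar> \<le> g $ i * s $ i" for i
  proof (cases "s $ i = 0")
    case False
    then have "0 < s $ i"
      using relaxed_set_nonneg[OF s, of i] by simp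
    then have "a i * s $ i = sqrt (s $ i)" "(a i)\<^sup>2 * s $ i = 1"
      by (simp_all add: a_def power_divide real_div_sqrt)
    then have "g $ i * s $ i = 2 * sqrt (s $ i) - v $ i"
      by (simp add: g_def left_diff_distrib mult.assoc)
    then show ?thesis by simp
  qed simp
  then have "(\<Sum>i\<in>UNIV. 2 * sqrt (s $ i) - \<bar>v $ i\<bar>) \<le> g \<bullet> s"
    unfolding inner_vec_def by (intro sum_mono) simp
  ultimately show ?thesis
    by (simp add: root_sum_def lp_norm_1 sum_subtractf flip: sum_distrib_left)
qed

text \<open>By the gradient condition and homogeneity,
  \<open>\<Sum>\<^sub>i ((A x)\<^sub>i)\<^sup>2 / v\<^sub>i \<le> \<sigma> \<parallel>B x\<parallel>\<^sup>2\<close> for all \<open>x\<close>; together with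
  \<open>2 y\<^sub>i (A x)\<^sub>i \<le> v\<^sub>i y\<^sub>i\<^sup>2 + ((A x)\<^sub>i)\<^sup>2 / v\<^sub>i\<close> this is the semidefinite constraint. The support condition
  takes care of the rows with \<open>v\<^sub>i = 0\<close>.\<close>

lemma relaxed_optimum_gives_feasible_point:
  fixes A :: "real ^ 'n ^ 'm" and B :: "real ^ 'n ^ 'l"
  assumes inj: "inj ((*v) B)" and s: "s \<in> relaxed_set A B"
    and max: "\<And>t. t \<in> relaxed_set A B \<Longrightarrow> root_sum t \<le> root_sum s"
  shows "((\<chi> i. sqrt (s $ i)), (\<chi> j. root_sum s)) \<in> K_set A B"
proof -
  have support: "t $ i = 0" if "t \<in> relaxed_set A B" "s $ i = 0" for t i
    by (rule root_sum_optimum_support[OF convex_relaxed_set relaxed_set_nonneg s max that])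
  have gradient: "(\<Sum>i\<in>UNIV. t $ i / sqrt (s $ i)) \<le> root_sum s" if "t \<in> relaxed_set A B" for t
    by (rule root_sum_optimum_gradient[OF convex_relaxed_set relaxed_set_nonneg s max that])
  have scaled: "s $ i = 0 \<Longrightarrow> (A *v x) $ i = 0"
    "(\<Sum>i\<in>UNIV. ((A *v x) $ i)\<^sup>2 / sqrt (s $ i)) \<le> root_sum s * (norm (B *v x))\<^sup>2" for x i
  proof -
    \<comment> \<open>the conditions hold on the unit ball; \<open>b = 0\<close> only for \<open>x = 0\<close>, where \<open>z = 0\<close> as well\<close>
    define b where "b = norm (B *v x)"
    define z where "z = (1 / b) *\<^sub>R x"
    have b: "b \<noteq> 0" if "x \<noteq> 0"
      using that injD[OF inj, of x 0] by (auto simp: b_def)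
    have x: "x = b *\<^sub>R z"
      using b by (cases "x = 0") (auto simp: z_def)
    have "norm (B *v z) \<le> 1"
      by (cases "B *v x = 0") (simp_all add: z_def b_def matrix_vector_mult_scaleR)
    note z = relaxed_set_generator[OF this, of A]
    show "(A *v x) $ i = 0" if "s $ i = 0"
      using support[OF z that] by (simp add: square_image_def x matrix_vector_mult_scaleR)
    have "b\<^sup>2 * (\<Sum>i\<in>UNIV. ((A *v z) $ i)\<^sup>2 / sqrt (s $ i)) \<le> b\<^sup>2 * root_sum s"
      using gradient[OF z] by (intro mult_left_mono) (auto simp: square_image_def)
    moreover have "(\<Sum>i\<in>UNIV. ((A *v x) $ i)\<^sup>2 / sqrt (s $ i))
        = b\<^sup>2 * (\<Sum>i\<in>UNIV. ((A *v z) $ i)\<^sup>2 / sqrt (s $ i))"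
      by (simp add: x matrix_vector_mult_scaleR power_mult_distrib sum_distrib_left)
    ultimately show "(\<Sum>i\<in>UNIV. ((A *v x) $ i)\<^sup>2 / sqrt (s $ i)) \<le> root_sum s * (norm (B *v x))\<^sup>2"
      by (simp add: b_def mult.commute)
  qed
  have young: "2 * (b * q) \<le> r * b\<^sup>2 + q\<^sup>2 / r" if "0 \<le> r" "r = 0 \<Longrightarrow> q = 0" for b q r :: real
  proof (cases "r = 0")
    case False
    then have "r * b\<^sup>2 + q\<^sup>2 / r - 2 * (b * q) = (r * b - q)\<^sup>2 / r"
      by (simp add: power2_eq_square field_simps)
    moreover have "0 \<le> (r * b - q)\<^sup>2 / r"
      using that(1) by simp
    ultimately show ?thesis by linarith
  qed (use that in simp)
  show ?thesis
    unfolding K_set_iff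
  proof (intro allI)
    fix y :: "real ^ 'm" and x :: "real ^ 'n"
    have "2 * (\<Sum>i\<in>UNIV. y $ i * (A *v x) $ i)
        \<le> (\<Sum>i\<in>UNIV. sqrt (s $ i) * (y $ i)\<^sup>2 + ((A *v x) $ i)\<^sup>2 / sqrt (s $ i))"
      unfolding sum_distrib_left using scaled(1) relaxed_set_nonneg[OF s]
      by (intro sum_mono young) auto
    also have "\<dots> \<le> (\<Sum>i\<in>UNIV. sqrt (s $ i) * (y $ i)\<^sup>2) + root_sum s * (norm (B *v x))\<^sup>2"
      using scaled(2)[of x] by (simp add: sum.distrib)
    finally show "2 * (\<Sum>i\<in>UNIV. y $ i * (A *v x) $ i)
      \<le> (\<Sum>i\<in>UNIV. (\<chi> i. sqrt (s $ i)) $ i * (y $ i)\<^sup>2)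
        + (\<Sum>j\<in>UNIV. (\<chi> j. root_sum s) $ j * ((B *v x) $ j)\<^sup>2)"
      by (simp add: norm_vec_sq sum_distrib_left)
  qed
qed

lemma sdp_min_eq:
  fixes A :: "real ^ 'n ^ 'm" and B :: "real ^ 'n ^ 'l"
  assumes inj: "inj ((*v) B)" and s: "s \<in> relaxed_set A B"
    and max: "\<And>t. t \<in> relaxed_set A B \<Longrightarrow> root_sum t \<le> root_sum s"
  shows "sdp_min A B = 2 * root_sum s"
  unfolding sdp_min_def
proof (rule Least_equality)
  let ?v = "\<chi> i. sqrt (s $ i) :: real ^ 'm" and ?w = "\<chi> j. root_sum s :: real ^ 'l"
  have nonneg: "0 \<le> s $ i" for i
    using relaxed_set_nonneg[OF s] .
  have "lp_norm 1 ?v = root_sum s"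
    using nonneg by (simp add: lp_norm_1 root_sum_def)
  moreover have "infnorm ?w = root_sum s"
    using nonneg by (simp add: infnorm_cart root_sum_def sum_nonneg)
  ultimately show "2 * root_sum s \<in> (\<lambda>(v, w). lp_norm 1 v + infnorm w) ` K_set A B"
    using relaxed_optimum_gives_feasible_point[OF assms] by (intro image_eqI[of _ _ "(?v, ?w)"]) auto
next
  fix r assume "r \<in> (\<lambda>(v, w). lp_norm 1 v + infnorm w) ` K_set A B"
  then show "2 * root_sum s \<le> r"
    using weak_duality[OF _ s] by auto
qed

section \<open>Gaussian rounding\<close>

definition gauss :: "'k set \<Rightarrow> ('k \<Rightarrow> real) measure"
  where "gauss I = PiM I (\<lambda>_. density lborel std_normal_density)"

lemma prob_space_gauss: "prob_space (gauss I)"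
  unfolding gauss_def by (intro prob_space_PiM prob_space_normal_density) simp

lemma gauss_coordinate_measurable [measurable]:
  "k \<in> I \<Longrightarrow> (\<lambda>\<omega>. \<omega> k) \<in> borel_measurable (gauss I)"
  unfolding gauss_def by measurable

lemma gauss_coordinate:
  assumes "k \<in> I"
  shows "distributed (gauss I) lborel (\<lambda>\<omega>. \<omega> k) std_normal_density"
proof -
  let ?D = "density lborel (\<lambda>x. ennreal (std_normal_density x))"
  have "distr (gauss I) lborel (\<lambda>\<omega>. \<omega> k) = distr (gauss I) ?D (\<lambda>\<omega>. \<omega> k)"
    by (rule distr_cong) auto
  also have "\<dots> = ?D"
    unfolding gauss_def using assms
    by (intro distr_PiM_component prob_space_normal_density) auto
  finally show ?thesis
    using assms by (auto simp: distributed_def)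
qed

lemma gauss_coordinates_indep:
  assumes "I \<noteq> {}"
  shows "prob_space.indep_vars (gauss I) (\<lambda>_. borel) (\<lambda>k \<omega>. \<omega> k) I"
proof -
  interpret prob_space "gauss I" by (rule prob_space_gauss)
  let ?D = "density lborel (\<lambda>x. ennreal (std_normal_density x))"
  have sets: "sets (gauss I) = sets (\<Pi>\<^sub>M k\<in>I. borel)"
    unfolding gauss_def by (intro sets_PiM_cong) auto
  have "distr (gauss I) (\<Pi>\<^sub>M k\<in>I. borel) (\<lambda>\<omega>. \<lambda>k\<in>I. \<omega> k) = distr (gauss I) (gauss I) (\<lambda>\<omega>. \<omega>)"
    using sets by (intro distr_cong) (auto simp: gauss_def space_PiM PiE_def extensional_def restrict_def)
  also have "\<dots> = gauss I"
    by (rule distr_id)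
  also have "\<dots> = (\<Pi>\<^sub>M k\<in>I. ?D)"
    by (rule gauss_def)
  also have "\<dots> = (\<Pi>\<^sub>M k\<in>I. distr (gauss I) borel (\<lambda>\<omega>. \<omega> k))"
  proof (rule PiM_cong)
    fix k assume "k \<in> I"
    then have "distr (gauss I) lborel (\<lambda>\<omega>. \<omega> k) = ?D"
      using gauss_coordinate[of k I] by (simp add: distributed_def)
    moreover have "distr (gauss I) borel (\<lambda>\<omega>. \<omega> k) = distr (gauss I) lborel (\<lambda>\<omega>. \<omega> k)"
      by (rule distr_cong) auto
    ultimately show "?D = distr (gauss I) borel (\<lambda>\<omega>. \<omega> k)"
      by simp
  qed simp
  finally show ?thesis
    using assms by (subst indep_vars_iff_distr_eq_PiM') auto
qed

text \<open>Vanishing coefficients have to be left out of the sum of independent normal variables, because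
  the constant \<open>0\<close> has no density.\<close>

lemma gauss_linear_form_normal:
  assumes "finite I" "\<exists>k\<in>I. c k \<noteq> 0"
  shows "distributed (gauss I) lborel (\<lambda>\<omega>. \<Sum>k\<in>I. c k * \<omega> k)
    (normal_density 0 (sqrt (\<Sum>k\<in>I. (c k)\<^sup>2)))"
proof -
  interpret prob_space "gauss I" by (rule prob_space_gauss)
  let ?J = "{k\<in>I. c k \<noteq> 0}"
  have "indep_vars (\<lambda>_. borel) (\<lambda>k \<omega>. c k * \<omega> k) ?J"
    by (rule indep_vars_compose2[OF indep_vars_subset[OF gauss_coordinates_indep]]) (use assms in auto)
  moreover have "distributed (gauss I) lborel (\<lambda>\<omega>. c k * \<omega> k) (normal_density 0 \<bar>c k\<bar>)"
    if "k \<in> ?J" for k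
    using normal_density_affine[OF gauss_coordinate[of k I], of "c k" 0] that by simp
  ultimately have "distributed (gauss I) lborel (\<lambda>\<omega>. \<Sum>k\<in>?J. c k * \<omega> k)
      (normal_density (\<Sum>k\<in>?J. 0) (sqrt (\<Sum>k\<in>?J. \<bar>c k\<bar>\<^sup>2)))"
    using assms by (intro sum_indep_normal) auto
  moreover have "(\<Sum>k\<in>?J. c k * \<omega> k) = (\<Sum>k\<in>I. c k * \<omega> k)" for \<omega> :: "'a \<Rightarrow> real"
    using assms(1) by (intro sum.mono_neutral_left) auto
  moreover have "(\<Sum>k\<in>?J. \<bar>c k\<bar>\<^sup>2) = (\<Sum>k\<in>I. (c k)\<^sup>2)"
    using assms(1) by (subst power2_abs, intro sum.mono_neutral_left) auto
  ultimately show ?thesis by simp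
qed

lemma gauss_linear_form_moments:
  fixes c :: "'k \<Rightarrow> real"
  assumes "finite I"
  shows "has_bochner_integral (gauss I) (\<lambda>\<omega>. \<bar>\<Sum>k\<in>I. c k * \<omega> k\<bar>)
      (sqrt (2 / pi) * sqrt (\<Sum>k\<in>I. (c k)\<^sup>2))" (is ?abs)
    and "has_bochner_integral (gauss I) (\<lambda>\<omega>. (\<Sum>k\<in>I. c k * \<omega> k)\<^sup>2) (\<Sum>k\<in>I. (c k)\<^sup>2)" (is ?sq)
proof -
  let ?s = "\<Sum>k\<in>I. (c k)\<^sup>2" and ?L = "\<lambda>\<omega>. \<Sum>k\<in>I. c k * \<omega> k"
  have "?abs \<and> ?sq"
  proof (cases "\<exists>k\<in>I. c k \<noteq> 0")
    case True
    then obtain k where "k \<in> I" "c k \<noteq> 0" by blast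
    then have s: "0 < ?s"
      using assms by (intro sum_pos2[of I k]) auto
    note D = gauss_linear_form_normal[OF assms True]
    have transfer: "has_bochner_integral (gauss I) (\<lambda>\<omega>. g (?L \<omega>)) e"
      if g: "g \<in> borel_measurable lborel"
        and e: "has_bochner_integral lborel (\<lambda>x. normal_density 0 (sqrt ?s) x * g x) e" for g :: "real \<Rightarrow> real" and e
      using e distributed_integrable[OF D g] distributed_integral[OF D g]
      by (simp add: has_bochner_integral_iff)
    have "?abs"
      using normal_moment_abs_odd[of "sqrt ?s" 0 0] s
      by (intro transfer[of abs]) (simp_all add: mult.commute)
    moreover have "?sq"
      using normal_moment_even[of "sqrt ?s" 0 1] s
      by (intro transfer[of "\<lambda>x. x\<^sup>2"]) (simp_all add: fact_numeral)
    ultimately show ?thesis by blast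
  next
    case False
    then show ?thesis by (simp add: has_bochner_integral_zero)
  qed
  then show ?abs ?sq by blast+
qed

text \<open>A bound of \<open>\<parallel>A x\<parallel>\<^sub>1\<close> by \<open>\<parallel>B x\<parallel>\<^sub>2\<close> extends to finite families \<open>y\<close>, with square functions in
  place of absolute values, at the cost of the factor \<open>\<surd>(\<pi>/2)\<close>: it is averaged over the Gaussian
  combinations of the \<open>y\<^sub>k\<close>. The factor is the ratio between the root mean square and the mean absolute
  value of a centred Gaussian.\<close>

lemma gaussian_extension:
  fixes A :: "real ^ 'n ^ 'm" and B :: "real ^ 'n ^ 'l" and y :: "'k \<Rightarrow> real ^ 'n"
  assumes bound: "\<And>x. (\<Sum>i\<in>UNIV. \<bar>(A *v x) $ i\<bar>) \<le> N * norm (B *v x)"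
    and "0 \<le> N" "finite I"
  shows "(\<Sum>i\<in>UNIV. sqrt (\<Sum>k\<in>I. ((A *v y k) $ i)\<^sup>2))
    \<le> sqrt (pi / 2) * N * sqrt (\<Sum>k\<in>I. (norm (B *v y k))\<^sup>2)"
proof -
  interpret prob_space "gauss I" by (rule prob_space_gauss)
  define z where "z \<omega> = (\<Sum>k\<in>I. \<omega> k *\<^sub>R y k)" for \<omega>
  let ?R = "\<Sum>k\<in>I. (norm (B *v y k))\<^sup>2"
  have coord: "(M *v z \<omega>) $ i = (\<Sum>k\<in>I. (M *v y k) $ i * \<omega> k)" for M :: "real ^ 'n ^ 'r" and \<omega> i
    by (simp add: z_def linear_sum[OF matrix_vector_mul_linear] matrix_vector_mult_scaleR mult.commute)
  have normsq: "(norm v)\<^sup>2 = (\<Sum>j\<in>UNIV. (v $ j)\<^sup>2)" for v :: "real ^ 'l"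
    by (simp add: norm_vec_def L2_set_def sum_nonneg)
  have A: "has_bochner_integral (gauss I) (\<lambda>\<omega>. \<Sum>i\<in>UNIV. \<bar>(A *v z \<omega>) $ i\<bar>)
      (\<Sum>i\<in>UNIV. sqrt (2 / pi) * sqrt (\<Sum>k\<in>I. ((A *v y k) $ i)\<^sup>2))"
    unfolding coord by (intro has_bochner_integral_sum gauss_linear_form_moments assms)
  have "has_bochner_integral (gauss I) (\<lambda>\<omega>. \<Sum>j\<in>UNIV. ((B *v z \<omega>) $ j)\<^sup>2)
      (\<Sum>j\<in>UNIV. \<Sum>k\<in>I. ((B *v y k) $ j)\<^sup>2)"
    unfolding coord by (intro has_bochner_integral_sum gauss_linear_form_moments assms)
  also have "(\<Sum>j\<in>UNIV. \<Sum>k\<in>I. ((B *v y k) $ j)\<^sup>2) = ?R"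
    by (subst sum.swap) (simp add: normsq)
  finally have B: "has_bochner_integral (gauss I) (\<lambda>\<omega>. (norm (B *v z \<omega>))\<^sup>2) ?R"
    by (simp add: normsq)
  have "(\<lambda>\<omega>. sqrt (\<Sum>j\<in>UNIV. (\<Sum>k\<in>I. (B *v y k) $ j * \<omega> k)\<^sup>2)) \<in> borel_measurable (gauss I)"
    by measurable
  then have meas: "(\<lambda>\<omega>. norm (B *v z \<omega>)) \<in> borel_measurable (gauss I)"
    by (simp add: norm_vec_def L2_set_def coord)
  have intsq: "integrable (gauss I) (\<lambda>\<omega>. (norm (B *v z \<omega>))\<^sup>2)"
    using B by (simp add: has_bochner_integral_iff)
  have int: "integrable (gauss I) (\<lambda>\<omega>. norm (B *v z \<omega>))"
    by (rule square_integrable_imp_integrable[OF meas intsq])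
  have "(expectation (\<lambda>\<omega>. norm (B *v z \<omega>)))\<^sup>2 \<le> expectation (\<lambda>\<omega>. (norm (B *v z \<omega>))\<^sup>2)"
    using variance_eq[OF int intsq] variance_positive[of "\<lambda>\<omega>. norm (B *v z \<omega>)"] by linarith
  also have "\<dots> = ?R"
    using B by (simp add: has_bochner_integral_iff)
  finally have E: "expectation (\<lambda>\<omega>. norm (B *v z \<omega>)) \<le> sqrt ?R"
    by (rule real_le_rsqrt)
  have "sqrt (2 / pi) * (\<Sum>i\<in>UNIV. sqrt (\<Sum>k\<in>I. ((A *v y k) $ i)\<^sup>2))
      = expectation (\<lambda>\<omega>. \<Sum>i\<in>UNIV. \<bar>(A *v z \<omega>) $ i\<bar>)"
    using A by (simp add: has_bochner_integral_iff sum_distrib_left)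
  also have "\<dots> \<le> expectation (\<lambda>\<omega>. N * norm (B *v z \<omega>))"
    using A int bound by (intro integral_mono) (auto simp: has_bochner_integral_iff)
  also have "\<dots> \<le> N * sqrt ?R"
    using E \<open>0 \<le> N\<close> by (simp add: mult_left_mono)
  finally have "sqrt (pi / 2) * (sqrt (2 / pi) * (\<Sum>i\<in>UNIV. sqrt (\<Sum>k\<in>I. ((A *v y k) $ i)\<^sup>2)))
      \<le> sqrt (pi / 2) * (N * sqrt ?R)"
    by (intro mult_left_mono) auto
  moreover have "sqrt (pi / 2) * sqrt (2 / pi) = 1"
    by (simp flip: real_sqrt_mult)
  ultimately show ?thesis
    by (simp flip: mult.assoc)
qed


text \<open>A point of the convex hull is a finite convex combination of vectors of squares; absorbing the
  weights \<open>u\<close> into \<open>y\<^sub>t = \<surd>u\<^sub>t x\<^sub>t\<close> makes it a vector of square functions.\<close>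

lemma root_sum_le_norm_bound:
  fixes A :: "real ^ 'n ^ 'm" and B :: "real ^ 'n ^ 'l"
  assumes bound: "\<And>x. lp_norm 1 (A *v x) \<le> N * norm (B *v x)" and "0 \<le> N"
    and s: "s \<in> relaxed_set A B"
  shows "root_sum s \<le> sqrt (pi / 2) * N"
proof -
  obtain S u where S: "finite S" "S \<subseteq> square_image A ` {x. norm (B *v x) \<le> 1}"
    and u: "\<forall>t\<in>S. 0 \<le> u t" "sum u S = 1" "(\<Sum>t\<in>S. u t *\<^sub>R t) = s"
    using s unfolding relaxed_set_def convex_hull_explicit by blast
  have "\<forall>t\<in>S. \<exists>x. norm (B *v x) \<le> 1 \<and> square_image A x = t"
    using S(2) by auto
  then obtain x where x: "\<And>t. t \<in> S \<Longrightarrow> norm (B *v x t) \<le> 1" "\<And>t. t \<in> S \<Longrightarrow> square_image A (x t) = t"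
    by metis
  define y where "y t = sqrt (u t) *\<^sub>R x t" for t
  have "(\<Sum>t\<in>S. ((A *v y t) $ i)\<^sup>2) = s $ i" for i
  proof -
    have "(\<Sum>t\<in>S. ((A *v y t) $ i)\<^sup>2) = (\<Sum>t\<in>S. u t * square_image A (x t) $ i)"
      using u(1) by (intro sum.cong) (simp_all add: y_def matrix_vector_mult_scaleR power_mult_distrib square_image_def)
    also have "\<dots> = (\<Sum>t\<in>S. u t * t $ i)"
      using x(2) by simp
    also have "\<dots> = s $ i"
      by (simp flip: u(3))
    finally show ?thesis .
  qed
  then have "root_sum s = (\<Sum>i\<in>UNIV. sqrt (\<Sum>t\<in>S. ((A *v y t) $ i)\<^sup>2))"
    by (simp add: root_sum_def)
  also have "\<dots> \<le> sqrt (pi / 2) * N * sqrt (\<Sum>t\<in>S. (norm (B *v y t))\<^sup>2)"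
    using bound \<open>0 \<le> N\<close> S(1) by (intro gaussian_extension) (auto simp: lp_norm_1)
  also have "(\<Sum>t\<in>S. (norm (B *v y t))\<^sup>2) \<le> sum u S"
  proof (rule sum_mono)
    fix t assume t: "t \<in> S"
    then have "(norm (B *v x t))\<^sup>2 \<le> 1"
      using x(1) by (simp add: abs_square_le_1)
    then show "(norm (B *v y t))\<^sup>2 \<le> u t"
      using t u(1) by (simp add: y_def matrix_vector_mult_scaleR power_mult_distrib mult_left_le)
  qed
  then have "sqrt (pi / 2) * N * sqrt (\<Sum>t\<in>S. (norm (B *v y t))\<^sup>2) \<le> sqrt (pi / 2) * N * 1"
    using \<open>0 \<le> N\<close> u(2) by (intro mult_left_mono) auto
  finally show ?thesis by simp
qed

section \<open>The two bounds\<close>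

theorem corollary5p11:
  fixes A :: "real ^ 'n ^ 'm" and B :: "real ^ 'n ^ 'l" and p :: real
  assumes "inj ((*v) B)" and "1 \<le> p" and "p < 2"
  shows "norm_p_to_1 p A B \<le> 1 / 2 * sdp_min A B
    \<and> 1 / 2 * sdp_min A B \<le> sqrt (pi / 2) * real CARD('l) powr (1 / p - 1 / 2) * norm_p_to_1 p A B"
proof -
  have p: "0 < p" "p \<le> 2"
    using assms by auto
  obtain s where s: "s \<in> relaxed_set A B"
    and max: "\<And>t. t \<in> relaxed_set A B \<Longrightarrow> root_sum t \<le> root_sum s"
    using relaxed_optimum_exists[OF assms(1)] by blast
  have sdp: "1 / 2 * sdp_min A B = root_sum s"
    using sdp_min_eq[OF assms(1) s max] by simp
  obtain x where x: "lp_norm p (B *v x) \<le> 1" "norm_p_to_1 p A B = lp_norm 1 (A *v x)"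
    using norm_p_to_1_attained[OF assms(1) p] by metis
  have "norm (B *v x) \<le> 1"
    using norm_le_1_if_lp_norm_le_1[OF p x(1)] .
  then have "norm_p_to_1 p A B \<le> root_sum s"
    using max[OF relaxed_set_generator] x(2) by (simp add: root_sum_square_image)
  moreover have "0 \<le> norm_p_to_1 p A B"
    by (simp add: x(2) lp_norm_1 sum_nonneg)
  then have "root_sum s \<le> sqrt (pi / 2) * (real CARD('l) powr (1 / p - 1 / 2) * norm_p_to_1 p A B)"
    using norm_p_to_1_bound[OF assms(1) p, of A] by (intro root_sum_le_norm_bound[OF _ _ s]) auto
  ultimately show ?thesis
    unfolding sdp by (simp add: mult.assoc)
qed

end
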